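(* Let $F$ be a field with a valuation $v$, valuation ring $O_v$ and value group $\Gamma_v$, let $E/F$ be a finite field extension, and let $w$ be a quasi-valuation on $E$ extending $v$, with $O_w=\{x\in E\mid w(x)\ge0\}$ and value monoid $M_w$. Let $P\in\mathrm{Spec}(O_v)$, let $H$ be its corresponding isolated subgroup of $\Gamma_v$, and let $\overline{hull_{M_w}(H^{\ge0})}$ be the closure of the PIM $hull_{M_w}(H^{\ge0})$ of $(M_w)^{\ge0}$. Let $$I=\{x\in O_w\mid w(x)\notin\overline{hull_{M_w}(H^{\ge0})}\},\qquad \mathcal Q=\{Q\in\mathrm{Spec}(O_w)\mid Q\cap O_v=P\}.$$ Then $\sqrt I=\bigcap_{Q\in\mathcal Q}Q$.
   Context: A totally ordered abelian monoid is a commutative monoid $(M,+)$ with a total order such that $a\le b$ implies $a+c\le b+c$. One adjoins $\infty$, greater than all elements of $M$, with $m+\infty=\infty$. A quasi-valuation on a ring $A$ is a function $w:A\to M\cup\{\infty\}$, $M$ a totally ordered abelian monoid, with $w(0)=\infty$, $w(xy)\ge w(x)+w(y)$ and $w(x+y)\ge\min\{w(x),w(y)\}$ for all $x,y\in A$. $w$ extends $v$ means that $\Gamma_v$ is contained in $M$ as an ordered submonoid and $w|_F=v$. $M_w$ is the submonoid of $M$ generated by $w(E\setminus\{0\})$ (for $x\neq 0$ one has $w(x)\neq\infty$); it contains $\Gamma_v$. A subgroup $H\le\Gamma_v$ is isolated if $0\le\gamma\le h\in H$ implies $\gamma\in H$; the isolated subgroup corresponding to a prime $P$ of $O_v$ is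 $\{\alpha\in\Gamma_v\mid\alpha\ne v(p)\text{ and }\alpha\ne-v(p)\text{ for all }p\in P\}$. For a subset $N$ of $M_w$, $N^{\ge0}=\{m\in N\mid m\ge0\}$. A PIM (positive isolated monoid) of $(M_w)^{\ge0}$ is a submonoid $N\subseteq(M_w)^{\ge0}$ such that $\gamma\in N$, $\delta\in(M_w)^{\ge0}$, $\delta\le\gamma$ imply $\delta\in N$. A PIM $N$ lies over $H^{\ge0}$ if $N\cap\Gamma_v=H^{\ge0}$. $hull_{M_w}(H^{\ge0})=\{m\in M_w\mid b_1\le m\le b_2\text{ for some }b_1,b_2\in H^{\ge0}\}$ is a PIM lying over $H^{\ge 0}$, and its closure $\overline{hull_{M_w}(H^{\ge0})}$ is the union of all PIMs lying over $H^{\ge0}$. The value $\infty$ is not in $M_w$, so $0\in I$. *)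

theory Defs
  imports "HOL-Algebra.Algebra"
begin

section \<open>Adjoining an infinite element\<close>

text \<open>Unlike \<^verbatim>\<open>HOL-Library.Extended\<close>, only a greatest element is added.\<close>

datatype 'a with_infty = Fin 'a | Infty

instantiation with_infty :: (linorder) linorder
begin

fun less_eq_with_infty :: "'a with_infty \<Rightarrow> 'a with_infty \<Rightarrow> bool" where
  "Fin a \<le> Fin b \<longleftrightarrow> a \<le> b"
| "_ \<le> Infty \<longleftrightarrow> True"
| "Infty \<le> Fin b \<longleftrightarrow> False"

definition less_with_infty :: "'a with_infty \<Rightarrow> 'a with_infty \<Rightarrow> bool" where
  "less_with_infty x y \<longleftrightarrow> x \<le> y \<and> \<not> y \<le> x"

instance
proof
  fix x y z :: "'a with_infty"
  show "x < y \<longleftrightarrow> x \<le> y \<and> \<not> y \<le> x" by (rule less_with_infty_def)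
  show "x \<le> x" by (cases x) auto
  show "x \<le> y \<Longrightarrow> y \<le> z \<Longrightarrow> x \<le> z" by (cases x; cases y; cases z) auto
  show "x \<le> y \<Longrightarrow> y \<le> x \<Longrightarrow> x = y" by (cases x; cases y) auto
  show "x \<le> y \<or> y \<le> x" by (cases x; cases y) auto
qed

end

instantiation with_infty :: (comm_monoid_add) comm_monoid_add
begin

definition zero_with_infty :: "'a with_infty" where
  "0 = Fin 0"

fun plus_with_infty :: "'a with_infty \<Rightarrow> 'a with_infty \<Rightarrow> 'a with_infty" where
  "Fin a + Fin b = Fin (a + b)"
| "Infty + y = Infty"
| "x + Infty = Infty"

instance
proof
  fix x y z :: "'a with_infty"
  show "x + y + z = x + (y + z)" by (cases x; cases y; cases z) (auto simp: ac_simps)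
  show "x + y = y + x" by (cases x; cases y) (auto simp: ac_simps)
  show "0 + x = x" by (cases x) (auto simp: zero_with_infty_def)
qed

end

instance with_infty :: ("{linorder, ordered_comm_monoid_add}") ordered_comm_monoid_add
proof
  fix x y z :: "'a with_infty"
  show "x \<le> y \<Longrightarrow> z + x \<le> z + y"
    by (cases x; cases y; cases z) (auto intro: add_left_mono)
qed

section \<open>Valuations and quasi-valuations\<close>

definition valuation ::
  "('a, 'b) ring_scheme \<Rightarrow> ('a \<Rightarrow> 'g::linordered_ab_group_add with_infty) \<Rightarrow> bool" where
  "valuation F v \<longleftrightarrow>
     (\<forall>x\<in>carrier F. v x = Infty \<longleftrightarrow> x = \<zero>\<^bsub>F\<^esub>) \<and>
     (\<forall>x\<in>carrier F. \<forall>y\<in>carrier F. v (x \<otimes>\<^bsub>F\<^esub> y) = v x + v y) \<and>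
     (\<forall>x\<in>carrier F. \<forall>y\<in>carrier F. v (x \<oplus>\<^bsub>F\<^esub> y) \<ge> min (v x) (v y))"

definition quasi_valuation ::
  "('a, 'b) ring_scheme \<Rightarrow> ('a \<Rightarrow> 'm::{linorder, ordered_comm_monoid_add} with_infty) \<Rightarrow> bool" where
  "quasi_valuation A w \<longleftrightarrow>
     w \<zero>\<^bsub>A\<^esub> = Infty \<and>
     (\<forall>x\<in>carrier A. \<forall>y\<in>carrier A. w (x \<otimes>\<^bsub>A\<^esub> y) \<ge> w x + w y) \<and>
     (\<forall>x\<in>carrier A. \<forall>y\<in>carrier A. w (x \<oplus>\<^bsub>A\<^esub> y) \<ge> min (w x) (w y))"

text \<open>The subset \<open>{x \<in> A | w(x) \<ge> 0}\<close>; it gives both \<open>O\<^sub>v\<close> and \<open>O\<^sub>w\<close>.\<close>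

definition nonneg_elements ::
  "('a, 'b) ring_scheme \<Rightarrow> ('a \<Rightarrow> 'm::{linorder, comm_monoid_add} with_infty) \<Rightarrow> 'a set" where
  "nonneg_elements A w = {x \<in> carrier A. w x \<ge> 0}"

definition finite_values ::
  "('a, 'b) ring_scheme \<Rightarrow> ('a \<Rightarrow> 'm with_infty) \<Rightarrow> 'm set" where
  "finite_values A w = {m. \<exists>x \<in> carrier A - {\<zero>\<^bsub>A\<^esub>}. w x = Fin m}"

text \<open>For a valuation on a field the finite values already form a group, the value group.\<close>

abbreviation value_group ::
  "('a, 'b) ring_scheme \<Rightarrow> ('a \<Rightarrow> 'g::linordered_ab_group_add with_infty) \<Rightarrow> 'g set" where
  "value_group F v \<equiv> finite_values F v"

definition add_submonoid :: "'m::comm_monoid_add set \<Rightarrow> bool" where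
  "add_submonoid N \<longleftrightarrow> 0 \<in> N \<and> (\<forall>a\<in>N. \<forall>b\<in>N. a + b \<in> N)"

definition value_monoid ::
  "('a, 'b) ring_scheme \<Rightarrow> ('a \<Rightarrow> 'm::comm_monoid_add with_infty) \<Rightarrow> 'm set" where
  "value_monoid E w = add_submonoid hull finite_values E w"

text \<open>
  The inclusion of the value group \<open>\<Gamma>\<close> into \<open>M\<close> is an embedding \<open>\<iota>\<close>; only its
  restriction to \<open>\<Gamma>\<close> matters.
\<close>

definition ordered_monoid_embedding ::
  "'g::linordered_ab_group_add set \<Rightarrow> ('g \<Rightarrow> 'm::{linorder, ordered_comm_monoid_add}) \<Rightarrow> bool" where
  "ordered_monoid_embedding \<Gamma> \<iota> \<longleftrightarrow>
     \<iota> 0 = 0 \<and>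
     (\<forall>a\<in>\<Gamma>. \<forall>b\<in>\<Gamma>. \<iota> (a + b) = \<iota> a + \<iota> b) \<and>
     (\<forall>a\<in>\<Gamma>. \<forall>b\<in>\<Gamma>. \<iota> a \<le> \<iota> b \<longleftrightarrow> a \<le> b)"

definition extends_along ::
  "('a, 'b) ring_scheme \<Rightarrow> ('g::linordered_ab_group_add \<Rightarrow> 'm::{linorder, ordered_comm_monoid_add})
    \<Rightarrow> ('a \<Rightarrow> 'g with_infty) \<Rightarrow> ('a \<Rightarrow> 'm with_infty) \<Rightarrow> bool" where
  "extends_along F \<iota> v w \<longleftrightarrow>
     ordered_monoid_embedding (value_group F v) \<iota> \<and>
     (\<forall>x\<in>carrier F. w x = map_with_infty \<iota> (v x))"

section \<open>Isolated subgroups and positive isolated monoids\<close>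

text \<open>\<open>\<alpha> \<noteq> - v(p)\<close> is written \<open>- \<alpha> \<noteq> v(p)\<close>, so that no negative of \<open>\<infinity>\<close> is needed.\<close>

definition isolated_subgroup_of_prime ::
  "('a, 'b) ring_scheme \<Rightarrow> ('a \<Rightarrow> 'g::linordered_ab_group_add with_infty) \<Rightarrow> 'a set \<Rightarrow> 'g set" where
  "isolated_subgroup_of_prime F v P =
     {\<alpha> \<in> value_group F v. \<forall>p\<in>P. Fin \<alpha> \<noteq> v p \<and> Fin (- \<alpha>) \<noteq> v p}"

definition nonneg_part :: "'m::{linorder, comm_monoid_add} set \<Rightarrow> 'm set" where
  "nonneg_part N = {m \<in> N. m \<ge> 0}"

definition PIM :: "'m::{linorder, ordered_comm_monoid_add} set \<Rightarrow> 'm set \<Rightarrow> bool" where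
  "PIM Mw N \<longleftrightarrow>
     add_submonoid N \<and> N \<subseteq> nonneg_part Mw \<and>
     (\<forall>\<gamma>\<in>N. \<forall>\<delta>\<in>nonneg_part Mw. \<delta> \<le> \<gamma> \<longrightarrow> \<delta> \<in> N)"

definition lies_over :: "'m set \<Rightarrow> 'm set \<Rightarrow> 'm set \<Rightarrow> bool" where
  "lies_over \<Gamma> N B \<longleftrightarrow> N \<inter> \<Gamma> = B"

definition order_hull :: "'m::linorder set \<Rightarrow> 'm set \<Rightarrow> 'm set" where
  "order_hull Mw B = {m \<in> Mw. \<exists>b1\<in>B. \<exists>b2\<in>B. b1 \<le> m \<and> m \<le> b2}"

text \<open>
  The union of all PIMs lying over the same subset of \<open>\<Gamma>\<close> as \<open>N\<close> does. For
  \<open>N = order_hull Mw H\<^sup>\<ge>\<^sup>0\<close> this subset is \<open>H\<^sup>\<ge>\<^sup>0\<close>, by the lemma below.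
\<close>

definition PIM_closure ::
  "'m::{linorder, ordered_comm_monoid_add} set \<Rightarrow> 'm set \<Rightarrow> 'm set \<Rightarrow> 'm set" where
  "PIM_closure Mw \<Gamma> N = \<Union> {N'. PIM Mw N' \<and> lies_over \<Gamma> N' (N \<inter> \<Gamma>)}"

lemma order_hull_PIM_lies_over:
  fixes Mw :: "'m::{linorder, ordered_comm_monoid_add} set"
  assumes Mw: "add_submonoid Mw" and \<Gamma>: "\<Gamma> \<subseteq> Mw"
    and B: "add_submonoid B" "B \<subseteq> nonneg_part \<Gamma>"
    and isolated: "\<And>\<gamma> h. \<gamma> \<in> \<Gamma> \<Longrightarrow> h \<in> B \<Longrightarrow> 0 \<le> \<gamma> \<Longrightarrow> \<gamma> \<le> h \<Longrightarrow> \<gamma> \<in> B"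
  shows "PIM Mw (order_hull Mw B)" and "lies_over \<Gamma> (order_hull Mw B) B"
proof -
  have 0: "0 \<in> B" "0 \<in> Mw" and nonneg: "\<And>b. b \<in> B \<Longrightarrow> 0 \<le> b"
    using B Mw by (auto simp: add_submonoid_def nonneg_part_def)
  have hull: "m \<in> order_hull Mw B \<longleftrightarrow> m \<in> Mw \<and> 0 \<le> m \<and> (\<exists>b\<in>B. m \<le> b)" for m
    using 0 nonneg by (force simp: order_hull_def intro: order_trans)
  have "a + b \<in> order_hull Mw B" if ab: "a \<in> order_hull Mw B" "b \<in> order_hull Mw B" for a b
  proof -
    from ab obtain a' b' where "a' \<in> B" "b' \<in> B" "a \<le> a'" "b \<le> b'"
      unfolding hull by blast
    then have "a' + b' \<in> B" "a + b \<le> a' + b'"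
      using B(1) by (auto simp: add_submonoid_def intro: add_mono)
    moreover have "a + b \<in> Mw" "0 \<le> a + b"
      using ab Mw by (auto simp: hull add_submonoid_def)
    ultimately show ?thesis unfolding hull by blast
  qed
  moreover have "0 \<in> order_hull Mw B" unfolding hull using 0 by auto
  moreover have "d \<in> order_hull Mw B" if "g \<in> order_hull Mw B" "d \<in> nonneg_part Mw" "d \<le> g" for g d
    using that unfolding hull nonneg_part_def by (blast intro: order_trans)
  moreover have "order_hull Mw B \<subseteq> nonneg_part Mw"
    by (auto simp: hull nonneg_part_def)
  ultimately show "PIM Mw (order_hull Mw B)"
    by (simp add: PIM_def add_submonoid_def)
  have "b \<in> \<Gamma> \<and> b \<in> order_hull Mw B" if "b \<in> B" for b
    using that B(2) \<Gamma> nonneg unfolding hull nonneg_part_def by blast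
  moreover have "g \<in> B" if "g \<in> \<Gamma>" "g \<in> order_hull Mw B" for g
    using that isolated unfolding hull by blast
  ultimately show "lies_over \<Gamma> (order_hull Mw B) B"
    unfolding lies_over_def by blast
qed

section \<open>Radicals\<close>

definition ideal_radical :: "('a, 'b) ring_scheme \<Rightarrow> 'a set \<Rightarrow> 'a set" where
  "ideal_radical R I = {x \<in> carrier R. \<exists>n::nat. n > 0 \<and> x [^]\<^bsub>R\<^esub> n \<in> I}"

end

theory Submission
  imports Defs
begin

text \<open>
  Multiplication by an element of \<open>F\<close> translates \<open>w\<close> by its value. If \<open>x \<in> I\<close> is nonzero,
  the values in \<open>(M\<^sub>w)\<^sup>\<ge>\<^sup>0\<close> bounded by some \<open>w(x\<^sup>n)\<close> form a PIM not contained in the closure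
  \<open>C\<close> of the hull. By maximality of \<open>C\<close> this PIM contains a value \<open>v(p)\<close> with \<open>p \<in> P\<close>, so
  \<open>x\<^sup>n\<close> is a multiple of \<open>p\<close> in \<open>O\<^sub>w\<close>; hence \<open>I \<subseteq> Q\<close> for each prime \<open>Q\<close> over \<open>P\<close>.
  Conversely, for \<open>x \<notin> \<surd>I\<close> the multiplicative set \<open>{x\<^sup>n a | a \<in> O\<^sub>v - P}\<close> misses \<open>I\<close>, because
  \<open>w(x\<^sup>n a) = w(x\<^sup>n) + v(a)\<close> is a sum of two elements of \<open>C\<close>. A prime ideal containing \<open>I\<close>
  and missing this set lies over \<open>P\<close> and does not contain \<open>x\<close>.
\<close>

section \<open>Prime ideals avoiding a multiplicative set\<close>

text \<open>Krull's argument: an ideal maximal among those containing \<open>I\<close> and disjoint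
  from \<open>S\<close> is prime, because every strictly larger ideal meets \<open>S\<close> and
  \<open>S\<close> is multiplicative.\<close>

lemma (in cring) exists_primeideal_disjoint:
  assumes I: "ideal I R"
    and S: "S \<subseteq> carrier R" "\<one> \<in> S" "\<And>s t. s \<in> S \<Longrightarrow> t \<in> S \<Longrightarrow> s \<otimes> t \<in> S"
    and IS: "I \<inter> S = {}"
  shows "\<exists>Q. primeideal Q R \<and> I \<subseteq> Q \<and> Q \<inter> S = {}"
proof -
  define A where "A = {J. ideal J R \<and> I \<subseteq> J \<and> J \<inter> S = {}}"
  have "\<exists>M\<in>A. \<forall>J\<in>A. M \<subseteq> J \<longrightarrow> J = M"
  proof (rule subset_Zorn_nonempty)
    show "A \<noteq> {}" using I IS unfolding A_def by blast
    fix K assume K: "K \<noteq> {}" "subset.chain A K"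
    have "subset.chain {J. ideal J R} K"
      using K(2) unfolding A_def subset.chain_def by auto
    from chain_Union_is_ideal[OF this] K(1) have "ideal (\<Union>K) R" by simp
    moreover have KA: "J \<in> K \<Longrightarrow> I \<subseteq> J \<and> J \<inter> S = {}" for J
      using K(2) unfolding A_def subset.chain_def by blast
    have "I \<subseteq> \<Union>K" using K(1) KA by blast
    moreover have "\<Union>K \<inter> S = {}" using KA by blast
    ultimately show "\<Union>K \<in> A" unfolding A_def by simp
  qed
  then obtain M where "M \<in> A" and max: "\<And>J. J \<in> A \<Longrightarrow> M \<subseteq> J \<Longrightarrow> J = M"
    by blast
  then have M: "ideal M R" "I \<subseteq> M" "M \<inter> S = {}" unfolding A_def by simp_all
  interpret M: ideal M R by fact
  have meets: "\<exists>m\<in>M. \<exists>r\<in>carrier R. m \<oplus> r \<otimes> a \<in> S" if a: "a \<in> carrier R" "a \<notin> M" for a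
  proof (rule ccontr)
    assume none: "\<not> ?thesis"
    let ?J = "M <+>\<^bsub>R\<^esub> PIdl a"
    have mem: "j \<in> ?J \<longleftrightarrow> (\<exists>m\<in>M. \<exists>r\<in>carrier R. j = m \<oplus> r \<otimes> a)" for j
      unfolding set_add_def' cgenideal_def by blast
    have "ideal ?J R" by (rule add_ideals[OF M(1) cgenideal_ideal[OF a(1)]])
    moreover have "M \<subseteq> ?J"
    proof
      fix m assume m: "m \<in> M"
      then have "m = m \<oplus> \<zero> \<otimes> a" using a(1) M.Icarr by simp
      with m show "m \<in> ?J" unfolding mem by blast
    qed
    moreover have "j \<notin> S" if "j \<in> ?J" for j using that none unfolding mem by blast
    then have "?J \<inter> S = {}" by blast
    ultimately have "?J = M" using M(2) by (intro max) (auto simp: A_def)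
    moreover have "a = \<zero> \<oplus> \<one> \<otimes> a" using a(1) by simp
    then have "a \<in> ?J" unfolding mem using additive_subgroup.zero_closed[OF M.is_additive_subgroup] by blast
    ultimately show False using a(2) by simp
  qed
  have "primeideal M R"
  proof (rule primeidealI[OF M(1) is_cring])
    show "carrier R \<noteq> M" using S M(3) by blast
    fix a b assume ab: "a \<in> carrier R" "b \<in> carrier R" "a \<otimes> b \<in> M"
    show "a \<in> M \<or> b \<in> M"
    proof (rule ccontr)
      assume "\<not> ?thesis"
      then obtain m r n s where *: "m \<in> M" "r \<in> carrier R" "m \<oplus> r \<otimes> a \<in> S"
        "n \<in> M" "s \<in> carrier R" "n \<oplus> s \<otimes> b \<in> S"
        using meets ab by metis
      have c: "m \<in> carrier R" "n \<in> carrier R" using * M.Icarr by auto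
      \<comment> \<open>Each summand on the right has a factor \<open>m\<close>, \<open>n\<close> or
        \<open>a \<otimes> b\<close>, all of them in \<open>M\<close>.\<close>
      have "(m \<oplus> r \<otimes> a) \<otimes> (n \<oplus> s \<otimes> b)
          = (n \<oplus> s \<otimes> b) \<otimes> m \<oplus> ((r \<otimes> a) \<otimes> n \<oplus> (r \<otimes> s) \<otimes> (a \<otimes> b))"
        using c * ab by algebra
      also have "\<dots> \<in> M"
      proof (intro additive_subgroup.a_closed[OF M.is_additive_subgroup])
        show "(n \<oplus> s \<otimes> b) \<otimes> m \<in> M" using * ab c by (intro M.I_l_closed) auto
        show "(r \<otimes> a) \<otimes> n \<in> M" using * ab c by (intro M.I_l_closed) auto
        show "(r \<otimes> s) \<otimes> (a \<otimes> b) \<in> M" by (rule M.I_l_closed) (use * ab in auto)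
      qed
      finally show False using S(3) * M(3) by blast
    qed
  qed
  with M show ?thesis by blast
qed

section \<open>Closures of positive isolated monoids\<close>

text \<open>As the order is total, the PIM containing the larger of two elements also contains the
  smaller, so their sum can be formed inside one member of the family.\<close>

lemma PIM_Union:
  assumes "\<N> \<noteq> {}" "\<And>N. N \<in> \<N> \<Longrightarrow> PIM M N"
  shows "PIM M (\<Union>\<N>)"
proof -
  have "a + b \<in> \<Union>\<N>" if ab: "a \<in> \<Union>\<N>" "b \<in> \<Union>\<N>" for a b
  proof -
    have "\<exists>N\<in>\<N>. a \<in> N \<and> b \<in> N"
      using ab assms(2) unfolding PIM_def by (meson UnionE linear subsetD)
    then show ?thesis using assms(2) unfolding PIM_def add_submonoid_def by blast
  qed
  moreover have "0 \<in> \<Union>\<N>"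
    using assms unfolding PIM_def add_submonoid_def by blast
  moreover have "\<Union>\<N> \<subseteq> nonneg_part M"
    "\<forall>\<gamma>\<in>\<Union>\<N>. \<forall>\<delta>\<in>nonneg_part M. \<delta> \<le> \<gamma> \<longrightarrow> \<delta> \<in> \<Union>\<N>"
    using assms(2) unfolding PIM_def by blast+
  ultimately show ?thesis unfolding PIM_def add_submonoid_def by blast
qed

text \<open>\<open>N\<close> itself belongs to the family whose union is the closure; this gives
  nonemptiness and the inclusion of \<open>N \<inter> \<Gamma>\<close>.\<close>

lemma PIM_closure:
  assumes "PIM M N"
  shows "PIM M (PIM_closure M \<Gamma> N)" and "PIM_closure M \<Gamma> N \<inter> \<Gamma> = N \<inter> \<Gamma>"
proof -
  show "PIM M (PIM_closure M \<Gamma> N)"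
    unfolding PIM_closure_def by (rule PIM_Union) (use assms in \<open>auto simp: lies_over_def\<close>)
  show "PIM_closure M \<Gamma> N \<inter> \<Gamma> = N \<inter> \<Gamma>"
    using assms unfolding PIM_closure_def lies_over_def by blast
qed

lemma PIM_closure_maximal:
  assumes "PIM M N'" "N' \<inter> \<Gamma> = N \<inter> \<Gamma>"
  shows "N' \<subseteq> PIM_closure M \<Gamma> N"
  using assms unfolding PIM_closure_def lies_over_def by blast

lemma finite_values_subset_value_monoid: "finite_values A w \<subseteq> value_monoid A w"
  unfolding value_monoid_def by (rule hull_subset)

lemma add_submonoid_value_monoid: "add_submonoid (value_monoid A w)"
  unfolding value_monoid_def by (rule hull_in) (auto simp: add_submonoid_def)

section \<open>Quasi-valuations extending a valuation of a subfield\<close>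

text \<open>The valuation of \<open>F\<close> is the restriction of \<open>w\<close>, so that no embedding of value groups is needed.\<close>

locale quasi_valuation_over_subfield = field E for E (structure) +
  fixes F :: "'a set"
    and w :: "'a \<Rightarrow> 'm::{linorder, ordered_comm_monoid_add} with_infty"
  assumes subfield: "subfield F E"
    and quasi_valuation: "quasi_valuation E w"
    and mult_subfield: "\<And>x y. x \<in> F \<Longrightarrow> y \<in> F \<Longrightarrow> w (x \<otimes> y) = w x + w y"
    and one [simp]: "w \<one> = 0"
begin

abbreviation O\<^sub>F where "O\<^sub>F \<equiv> nonneg_elements (E\<lparr>carrier := F\<rparr>) w"
abbreviation O\<^sub>E where "O\<^sub>E \<equiv> nonneg_elements E w"
abbreviation \<Gamma> where "\<Gamma> \<equiv> finite_values (E\<lparr>carrier := F\<rparr>) w"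
abbreviation M where "M \<equiv> value_monoid E w"

lemma subfield_carrier: "x \<in> F \<Longrightarrow> x \<in> carrier E"
  using subfieldE(3)[OF subfield] by blast

lemma one_mem: "\<one> \<in> F"
  using subringE(3)[OF subfieldE(1)[OF subfield]] .

lemma mem_O\<^sub>F: "x \<in> O\<^sub>F \<longleftrightarrow> x \<in> F \<and> 0 \<le> w x"
  by (simp add: nonneg_elements_def)

lemma mem_O\<^sub>E: "x \<in> O\<^sub>E \<longleftrightarrow> x \<in> carrier E \<and> 0 \<le> w x"
  by (simp add: nonneg_elements_def)

lemma O\<^sub>F_subset: "O\<^sub>F \<subseteq> O\<^sub>E"
  by (auto simp: mem_O\<^sub>F mem_O\<^sub>E subfield_carrier)

section \<open>Values of products with elements of \<open>F\<close>\<close>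

lemma zero: "w \<zero> = Infty"
  and mult: "x \<in> carrier E \<Longrightarrow> y \<in> carrier E \<Longrightarrow> w x + w y \<le> w (x \<otimes> y)"
  and add: "x \<in> carrier E \<Longrightarrow> y \<in> carrier E \<Longrightarrow> min (w x) (w y) \<le> w (x \<oplus> y)"
  using quasi_valuation by (auto simp: quasi_valuation_def)

lemma le_Infty [simp]: "(a::'m with_infty) \<le> Infty"
  by (cases a) auto

text \<open>A nonzero \<open>x\<close> is a unit of \<open>E\<close>, and an infinite
  \<open>w x\<close> would make \<open>w \<one>\<close> infinite by superadditivity.\<close>

lemma finite_value:
  assumes "x \<in> carrier E" "x \<noteq> \<zero>"
  obtains m where "w x = Fin m"
proof (cases "w x")
  case Infty
  have "x \<in> Units E" using assms field_Units by auto
  then have "w x + w (inv x) \<le> w \<one>" using mult[of x "inv x"] by auto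
  with Infty show ?thesis by (auto simp: zero_with_infty_def)
qed

lemma inverse:
  assumes "a \<in> F" "a \<noteq> \<zero>"
  shows "inv a \<in> F" "a \<otimes> inv a = \<one>" "w a + w (inv a) = 0"
proof -
  show "inv a \<in> F" "a \<otimes> inv a = \<one>"
    using subfield_m_inv[OF subfield, of a] assms by auto
  then show "w a + w (inv a) = 0"
    using mult_subfield[of a "inv a"] assms by simp
qed

text \<open>Superadditivity for the pair \<open>a\<close>, \<open>x\<close> gives one inequality;
  for the pair \<open>inv a\<close>, \<open>a \<otimes> x\<close>, shifted by \<open>w a\<close>, it
  gives the other.\<close>

lemma mult_left:
  assumes a: "a \<in> F" and x: "x \<in> carrier E"
  shows "w (a \<otimes> x) = w a + w x"
proof (cases "a = \<zero>")
  case True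
  with x show ?thesis by (simp add: zero)
next
  case False
  note i = inverse[OF a False]
  have c: "a \<in> carrier E" "inv a \<in> carrier E" using a i subfield_carrier by auto
  then have "inv a \<otimes> (a \<otimes> x) = x"
    using x i(2) m_comm[of a "inv a"] by (simp flip: m_assoc)
  then have "w (inv a) + w (a \<otimes> x) \<le> w x"
    using mult[of "inv a" "a \<otimes> x"] c x by simp
  then have "w a + (w (inv a) + w (a \<otimes> x)) \<le> w a + w x"
    by (rule add_left_mono)
  then have "w (a \<otimes> x) \<le> w a + w x" using i(3) by (simp flip: add.assoc)
  then show ?thesis using mult[of a x] c x by (intro antisym)
qed

text \<open>Turns a comparison of values into divisibility in \<open>O\<^sub>E\<close>, since
  \<open>w (inv p)\<close> is the additive inverse of \<open>w p\<close>.\<close>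

lemma dvd_if_le:
  assumes p: "p \<in> F" "p \<noteq> \<zero>" and x: "x \<in> carrier E" "w p \<le> w x"
  shows "inv p \<otimes> x \<in> O\<^sub>E" "p \<otimes> (inv p \<otimes> x) = x"
proof -
  note i = inverse[OF p]
  have c: "p \<in> carrier E" "inv p \<in> carrier E" using p i subfield_carrier by auto
  have "w (inv p) + w p \<le> w (inv p) + w x" by (rule add_left_mono[OF x(2)])
  then have "0 \<le> w (inv p) + w x" using i(3) by (simp add: add.commute)
  then show "inv p \<otimes> x \<in> O\<^sub>E"
    using mult_left[OF i(1) x(1)] c x by (simp add: mem_O\<^sub>E)
  show "p \<otimes> (inv p \<otimes> x) = x" using c x i(2) by (simp flip: m_assoc)
qed

text \<open>The sign is carried by \<open>\<ominus> \<one>\<close>, an element of \<open>F\<close>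
  with square \<open>\<one>\<close>. Its value doubles to 0, which rules out a negative
  value.\<close>

lemma a_inv: "x \<in> carrier E \<Longrightarrow> w x \<le> w (\<ominus> x)"
proof -
  assume x: "x \<in> carrier E"
  have neg: "\<ominus> \<one> \<in> F"
    using subringE(5)[OF subfieldE(1)[OF subfield] one_mem] .
  have "\<ominus> \<one> \<otimes> \<ominus> \<one> = \<one>" by (simp add: l_minus)
  then have sq: "w (\<ominus> \<one>) + w (\<ominus> \<one>) = 0"
    using mult_subfield[OF neg neg] by simp
  have "0 \<le> w (\<ominus> \<one>)"
  proof (rule ccontr)
    assume "\<not> ?thesis"
    then have "w (\<ominus> \<one>) < 0" by simp
    then have "w (\<ominus> \<one>) + w (\<ominus> \<one>) \<le> w (\<ominus> \<one>) + 0" by (intro add_left_mono) simp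
    with sq \<open>w (\<ominus> \<one>) < 0\<close> show False by simp
  qed
  then have "0 + w x \<le> w (\<ominus> \<one>) + w x" by (rule add_right_mono)
  also have "\<dots> = w (\<ominus> \<one> \<otimes> x)" using mult_left[OF neg x] by simp
  also have "\<ominus> \<one> \<otimes> x = \<ominus> x" using x by (simp add: l_minus)
  finally show ?thesis by simp
qed

section \<open>The ring \<open>O\<^sub>E\<close> and its ideals\<close>

lemma subring_O\<^sub>E: "subring O\<^sub>E E"
proof (rule subringI)
  show "O\<^sub>E \<subseteq> carrier E" "\<one> \<in> O\<^sub>E" by (simp_all add: nonneg_elements_def)
  show "\<ominus> x \<in> O\<^sub>E" if "x \<in> O\<^sub>E" for x
    using that order_trans[OF _ a_inv, of 0 x] by (simp add: mem_O\<^sub>E)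
  fix x y assume "x \<in> O\<^sub>E" "y \<in> O\<^sub>E"
  then have xy: "x \<in> carrier E" "y \<in> carrier E" and nonneg: "0 \<le> w x" "0 \<le> w y"
    by (simp_all add: mem_O\<^sub>E)
  have "0 \<le> w x + w y" by (rule add_nonneg_nonneg[OF nonneg])
  also have "\<dots> \<le> w (x \<otimes> y)" by (rule mult[OF xy])
  finally show "x \<otimes> y \<in> O\<^sub>E" using xy by (simp add: mem_O\<^sub>E)
  have "0 \<le> min (w x) (w y)" using nonneg by simp
  also have "\<dots> \<le> w (x \<oplus> y)" by (rule add[OF xy])
  finally show "x \<oplus> y \<in> O\<^sub>E" using xy by (simp add: mem_O\<^sub>E)
qed

lemma cring_O\<^sub>E: "cring (E\<lparr>carrier := O\<^sub>E\<rparr>)"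
  using subcring_iff subcringI'[OF subring_O\<^sub>E] mem_O\<^sub>E by blast

lemma nat_pow_O\<^sub>E: "x [^]\<^bsub>E\<lparr>carrier := O\<^sub>E\<rparr>\<^esub> (n::nat) = x [^] n"
  by (rule nat_pow_consistent[symmetric])

lemma nat_pow_closed_O\<^sub>E: "x \<in> O\<^sub>E \<Longrightarrow> x [^] (n::nat) \<in> O\<^sub>E"
  by (induction n) (use subringE(3,6)[OF subring_O\<^sub>E] in auto)

lemma ideal_O\<^sub>E:
  assumes "J \<subseteq> O\<^sub>E" "\<zero> \<in> J" "\<And>x y. x \<in> J \<Longrightarrow> y \<in> J \<Longrightarrow> x \<oplus> y \<in> J"
    "\<And>x. x \<in> J \<Longrightarrow> \<ominus> x \<in> J" "\<And>x r. x \<in> J \<Longrightarrow> r \<in> O\<^sub>E \<Longrightarrow> r \<otimes> x \<in> J"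
  shows "ideal J (E\<lparr>carrier := O\<^sub>E\<rparr>)"
proof -
  interpret R: cring "E\<lparr>carrier := O\<^sub>E\<rparr>" by (rule cring_O\<^sub>E)
  have c: "x \<in> J \<Longrightarrow> x \<in> carrier E" for x using assms(1) mem_O\<^sub>E by blast
  \<comment> \<open>Negation in the restricted ring is defined inside that ring; uniqueness of
    additive inverses identifies it with negation in \<open>E\<close>.\<close>
  have minus: "\<ominus>\<^bsub>E\<lparr>carrier := O\<^sub>E\<rparr>\<^esub> x = \<ominus> x" if "x \<in> J" for x
  proof (rule R.minus_equality)
    show "\<ominus> x \<oplus>\<^bsub>E\<lparr>carrier := O\<^sub>E\<rparr>\<^esub> x = \<zero>\<^bsub>E\<lparr>carrier := O\<^sub>E\<rparr>\<^esub>"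
      using c[OF that] l_neg by simp
  qed (use that assms in auto)
  show ?thesis
  proof (rule idealI[OF R.ring_axioms])
    show "subgroup J (add_monoid (E\<lparr>carrier := O\<^sub>E\<rparr>))"
    proof (rule R.add.subgroupI)
      fix x assume "x \<in> J"
      then show "\<ominus>\<^bsub>E\<lparr>carrier := O\<^sub>E\<rparr>\<^esub> x \<in> J" using minus assms(4) by simp
    qed (use assms in auto)
    fix x r assume "x \<in> J" "r \<in> carrier (E\<lparr>carrier := O\<^sub>E\<rparr>)"
    then show "r \<otimes>\<^bsub>E\<lparr>carrier := O\<^sub>E\<rparr>\<^esub> x \<in> J" "x \<otimes>\<^bsub>E\<lparr>carrier := O\<^sub>E\<rparr>\<^esub> r \<in> J"
      using assms(5)[of x r] m_comm[of x r] c mem_O\<^sub>E by auto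
  qed
qed

end

section \<open>The ideal attached to a prime of the valuation ring\<close>

locale quasi_valuation_over_prime = quasi_valuation_over_subfield E F w
  for E (structure) and F and w :: "'a \<Rightarrow> 'm::{linorder, ordered_comm_monoid_add} with_infty" +
  fixes P :: "'a set"
  assumes prime: "primeideal P (E\<lparr>carrier := O\<^sub>F\<rparr>)"
begin

interpretation P: primeideal P "E\<lparr>carrier := O\<^sub>F\<rparr>"
  by (rule prime)

text \<open>This is \<open>H\<^sup>\<ge>\<^sup>0\<close> for the isolated subgroup \<open>H\<close> corresponding to \<open>P\<close>.\<close>

definition B where "B = {m. \<exists>x\<in>O\<^sub>F - P. w x = Fin m}"

definition C where "C = PIM_closure M \<Gamma> (order_hull M B)"

definition I where "I = {x \<in> O\<^sub>E. w x \<notin> Fin ` C}"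

section \<open>The prime \<open>P\<close> in terms of values\<close>

lemma P_subset: "P \<subseteq> O\<^sub>F"
  using P.a_subset by simp

lemma zero_in_P: "\<zero> \<in> P"
  using additive_subgroup.zero_closed[OF P.is_additive_subgroup] by simp

lemma one_notin_P: "\<one> \<in> O\<^sub>F - P"
  using P.one_imp_carrier P.I_notcarr one_mem by (auto simp: mem_O\<^sub>F)

lemma mult_notin_P: "x \<in> O\<^sub>F - P \<Longrightarrow> y \<in> O\<^sub>F - P \<Longrightarrow> x \<otimes> y \<in> O\<^sub>F - P"
  using P.I_prime[of x y] P.m_closed[of x y] by auto

text \<open>By \<open>dvd_if_le\<close>, \<open>x\<close> is a multiple of \<open>p\<close> in
  \<open>O\<^sub>F\<close>. If \<open>p\<close> is zero, then \<open>w x\<close> is infinite and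
  \<open>x\<close> is zero as well.\<close>

lemma P_upward_closed:
  assumes "p \<in> P" "x \<in> O\<^sub>F" "w p \<le> w x"
  shows "x \<in> P"
proof (cases "p = \<zero>")
  case True
  then have "w x = Infty" using assms(3) by (cases "w x") (auto simp: zero)
  then have "x = \<zero>"
    using finite_value[of x] assms(2) subfield_carrier mem_O\<^sub>F by force
  then show ?thesis using zero_in_P by simp
next
  case False
  have x: "x \<in> F" "x \<in> carrier E" and p: "p \<in> F"
    using assms P_subset subfield_carrier by (auto simp: mem_O\<^sub>F)
  have "inv p \<otimes> x \<in> O\<^sub>F"
    using dvd_if_le[OF p False x(2) assms(3)] inverse(1)[OF p False] x(1)
      subringE(6)[OF subfieldE(1)[OF subfield]] by (auto simp: mem_O\<^sub>F mem_O\<^sub>E)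
  then have "p \<otimes> (inv p \<otimes> x) \<in> P" using P.I_r_closed assms(1) by simp
  then show ?thesis using dvd_if_le(2)[OF p False x(2) assms(3)] by simp
qed

text \<open>Membership in \<open>P\<close> depends only on the value, by
  \<open>P_upward_closed\<close>; a value attained outside \<open>P\<close> is therefore never
  attained in \<open>P\<close>.\<close>

lemma value_in_B_iff:
  assumes "x \<in> O\<^sub>F"
  shows "w x \<in> Fin ` B \<longleftrightarrow> x \<notin> P"
proof
  assume "w x \<in> Fin ` B"
  then show "x \<notin> P" using P_upward_closed[of x] unfolding B_def by force
next
  assume x: "x \<notin> P"
  then have "x \<noteq> \<zero>" "x \<in> carrier E"
    using zero_in_P assms by (auto simp: mem_O\<^sub>F subfield_carrier)
  then obtain m where "w x = Fin m" using finite_value by blast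
  then show "w x \<in> Fin ` B" using assms x unfolding B_def by blast
qed

lemma \<Gamma>_subset: "\<Gamma> \<subseteq> M"
proof -
  have "\<Gamma> \<subseteq> finite_values E w"
    by (auto simp: finite_values_def subfield_carrier)
  then show ?thesis using finite_values_subset_value_monoid by blast
qed

lemma value_in_M: "x \<in> carrier E \<Longrightarrow> w x = Fin m \<Longrightarrow> m \<in> M"
  using finite_values_subset_value_monoid[of E w] zero unfolding finite_values_def by fastforce

text \<open>\<open>B\<close> is closed under addition because the complement of \<open>P\<close> is
  multiplicative and \<open>w\<close> is additive on \<open>F\<close>; it is isolated because
  \<open>P\<close> is upward closed.\<close>

lemma hull_B: "PIM M (order_hull M B)" "order_hull M B \<inter> \<Gamma> = B"
proof -
  have sub: "add_submonoid B"
    unfolding add_submonoid_def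
  proof (intro conjI ballI)
    show "0 \<in> B" using one_notin_P one unfolding B_def zero_with_infty_def by blast
    fix a b assume "a \<in> B" "b \<in> B"
    then obtain x y where xy: "x \<in> O\<^sub>F - P" "y \<in> O\<^sub>F - P" "w x = Fin a" "w y = Fin b"
      unfolding B_def by blast
    then have "w (x \<otimes> y) = Fin (a + b)" by (simp add: mult_subfield mem_O\<^sub>F)
    then show "a + b \<in> B" using mult_notin_P[OF xy(1,2)] unfolding B_def by blast
  qed
  have nonneg: "B \<subseteq> nonneg_part \<Gamma>"
  proof
    fix b assume "b \<in> B"
    then obtain x where x: "x \<in> O\<^sub>F" "x \<notin> P" "w x = Fin b" unfolding B_def by blast
    then have "x \<in> F - {\<zero>}" "0 \<le> b"
      using zero_in_P by (auto simp: mem_O\<^sub>F zero_with_infty_def)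
    then show "b \<in> nonneg_part \<Gamma>"
      using x(3) unfolding nonneg_part_def finite_values_def by auto
  qed
  have "\<gamma> \<in> B" if *: "\<gamma> \<in> \<Gamma>" "h \<in> B" "0 \<le> \<gamma>" "\<gamma> \<le> h" for \<gamma> h
  proof -
    from * obtain x y where x: "x \<in> F" "w x = Fin \<gamma>" and y: "y \<in> O\<^sub>F" "y \<notin> P" "w y = Fin h"
      unfolding finite_values_def B_def by auto
    have "x \<in> O\<^sub>F" using x *(3) by (simp add: mem_O\<^sub>F zero_with_infty_def)
    moreover have "x \<notin> P" using P_upward_closed[of x y] x y *(4) by auto
    ultimately show ?thesis using x(2) unfolding B_def by blast
  qed
  note hull = order_hull_PIM_lies_over[OF add_submonoid_value_monoid \<Gamma>_subset sub nonneg this]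
  show "PIM M (order_hull M B)" "order_hull M B \<inter> \<Gamma> = B"
    using hull unfolding lies_over_def by auto
qed

section \<open>The closure \<open>C\<close> and the ideal \<open>I\<close>\<close>

lemma PIM_C: "PIM M C" and C_over_B: "C \<inter> \<Gamma> = B"
  using PIM_closure[OF hull_B(1)] hull_B(2) unfolding C_def by auto

text \<open>Passing from \<open>B\<close> to \<open>C\<close> adds no values of \<open>F\<close>, by
  \<open>C_over_B\<close>. Zero is treated apart because its value is infinite.\<close>

lemma value_in_C_iff:
  assumes "x \<in> O\<^sub>F"
  shows "w x \<in> Fin ` C \<longleftrightarrow> x \<notin> P"
proof (cases "x = \<zero>")
  case True
  then show ?thesis using zero_in_P by (auto simp: zero)
next
  case False
  then have "w x \<in> Fin ` C \<longleftrightarrow> w x \<in> Fin ` B"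
    using assms unfolding C_over_B[symmetric] by (auto simp: mem_O\<^sub>F finite_values_def)
  then show ?thesis using value_in_B_iff[OF assms] by simp
qed

text \<open>\<open>C\<close> is downward closed in \<open>nonneg_part M\<close>, so the values
  outside it are upward closed.\<close>

lemma I_upward_closed:
  assumes "x \<in> I" "y \<in> O\<^sub>E" "w x \<le> w y"
  shows "y \<in> I"
proof (rule ccontr)
  assume "y \<notin> I"
  then obtain c where c: "c \<in> C" "w y = Fin c" using assms(2) unfolding I_def by auto
  with assms(3) obtain m where m: "w x = Fin m" "m \<le> c" by (cases "w x") auto
  have "m \<in> nonneg_part M"
    using assms(1) m(1) value_in_M by (auto simp: I_def mem_O\<^sub>E nonneg_part_def zero_with_infty_def)
  then have "m \<in> C" using PIM_C c(1) m(2) unfolding PIM_def by blast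
  with assms(1) m(1) show False unfolding I_def by auto
qed

text \<open>Everything but \<open>\<zero> \<in> I\<close> reduces to \<open>I_upward_closed\<close>:
  negation and multiplication by \<open>O\<^sub>E\<close> do not lower values, and a sum has at
  least the value of one summand.\<close>

lemma ideal_I: "ideal I (E\<lparr>carrier := O\<^sub>E\<rparr>)"
proof (rule ideal_O\<^sub>E)
  note O = subringE[OF subring_O\<^sub>E]
  show "I \<subseteq> O\<^sub>E" unfolding I_def by blast
  show "\<zero> \<in> I" using O(2) by (auto simp: I_def zero)
  fix x assume x: "x \<in> I"
  then have xO: "x \<in> O\<^sub>E" "x \<in> carrier E" "0 \<le> w x" by (auto simp: I_def mem_O\<^sub>E)
  show "\<ominus> x \<in> I" using I_upward_closed[OF x] O(5) a_inv xO by blast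
  show "r \<otimes> x \<in> I" if r: "r \<in> O\<^sub>E" for r
  proof (rule I_upward_closed[OF x])
    show "r \<otimes> x \<in> O\<^sub>E" using O(6) r xO by blast
    have "0 + w x \<le> w r + w x" using r by (intro add_right_mono) (simp add: mem_O\<^sub>E)
    also have "\<dots> \<le> w (r \<otimes> x)" using r xO mult by (simp add: mem_O\<^sub>E)
    finally show "w x \<le> w (r \<otimes> x)" by simp
  qed
  show "x \<oplus> y \<in> I" if y: "y \<in> I" for y
  proof -
    have yO: "y \<in> O\<^sub>E" "y \<in> carrier E" using y by (auto simp: I_def mem_O\<^sub>E)
    have "w x \<le> w (x \<oplus> y) \<or> w y \<le> w (x \<oplus> y)"
      using add[of x y] xO yO by (auto simp: min_le_iff_disj)
    then show ?thesis using I_upward_closed x y O(7)[OF xO(1) yO(1)] by blast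
  qed
qed

lemma P_subset_I: "P \<subseteq> I"
  using value_in_C_iff P_subset O\<^sub>F_subset unfolding I_def by blast

text \<open>\<open>mult_left\<close> supplies the exact value of the product; superadditivity alone
  bounds it only from below and could not keep it in \<open>C\<close>.\<close>

lemma mult_notin_I:
  assumes x: "x \<in> O\<^sub>E - I" and a: "a \<in> O\<^sub>F - P"
  shows "x \<otimes> a \<notin> I"
proof -
  from x obtain c where c: "c \<in> C" "w x = Fin c" unfolding I_def by auto
  from a value_in_C_iff obtain d where d: "d \<in> C" "w a = Fin d" by blast
  have "x \<otimes> a = a \<otimes> x" using x a m_comm by (simp add: mem_O\<^sub>E mem_O\<^sub>F subfield_carrier)
  then have "w (x \<otimes> a) = Fin (d + c)"
    using mult_left[of a x] x a c d by (simp add: mem_O\<^sub>E mem_O\<^sub>F)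
  moreover have "d + c \<in> C" using PIM_C c d unfolding PIM_def add_submonoid_def by blast
  ultimately show ?thesis unfolding I_def by auto
qed

section \<open>Containment of \<open>I\<close> in the primes over \<open>P\<close>\<close>

text \<open>Maximality of \<open>C\<close> is applied to the PIM generated by the values of the powers of \<open>x\<close>.\<close>

lemma ex_value_le_nat_pow:
  assumes x: "x \<in> I" "x \<noteq> \<zero>"
  obtains p n where "p \<in> P" "p \<noteq> \<zero>" "w p \<le> w (x [^] (n::nat))"
proof -
  \<comment> \<open>Exponent 0 accounts for \<open>0 \<in> N\<close>, and
    \<open>x [^] (i + j)\<close> for closure under sums.\<close>
  define N where "N = {k \<in> nonneg_part M. \<exists>n::nat. Fin k \<le> w (x [^] n)}"
  have xO: "x \<in> O\<^sub>E" "x \<in> carrier E" "0 \<le> w x" using x by (auto simp: I_def mem_O\<^sub>E)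
  obtain m where m: "w x = Fin m" using finite_value xO x(2) by blast
  have mM: "m \<in> nonneg_part M"
    using m xO value_in_M by (auto simp: nonneg_part_def zero_with_infty_def)
  have "Fin m \<le> w (x [^] (1::nat))" using m xO by simp
  then have mN: "m \<in> N" using mM unfolding N_def by blast
  have mC: "m \<notin> C" using x m unfolding I_def by auto
  have M: "0 \<in> M" "\<And>k l. k \<in> M \<Longrightarrow> l \<in> M \<Longrightarrow> k + l \<in> M"
    using add_submonoid_value_monoid unfolding add_submonoid_def by auto
  have "PIM M N"
    unfolding PIM_def add_submonoid_def
  proof (intro conjI ballI impI)
    have "Fin 0 \<le> w (x [^] (0::nat))" by (simp add: zero_with_infty_def)
    then show "0 \<in> N" using M(1) unfolding N_def nonneg_part_def by blast
    show "N \<subseteq> nonneg_part M" unfolding N_def by blast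
    show "d \<in> N" if "c \<in> N" "d \<in> nonneg_part M" "d \<le> c" for c d
    proof -
      have "Fin d \<le> Fin c" using that by simp
      then show ?thesis using that unfolding N_def by (blast intro: order_trans)
    qed
    fix k l assume "k \<in> N" "l \<in> N"
    then obtain i j :: nat where ij: "Fin k \<le> w (x [^] i)" "Fin l \<le> w (x [^] j)"
      and kl: "k \<in> nonneg_part M" "l \<in> nonneg_part M" unfolding N_def by blast
    have "Fin (k + l) \<le> w (x [^] i) + w (x [^] j)"
      using add_mono[OF ij] by simp
    also have "\<dots> \<le> w (x [^] (i + j))"
      using mult[of "x [^] i" "x [^] j"] xO by (simp add: nat_pow_mult)
    finally show "k + l \<in> N"
      using kl M(2)[of k l] unfolding N_def nonneg_part_def by auto
  qed
  \<comment> \<open>As \<open>m\<close> lies outside the downward closed \<open>C\<close>, all of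
    \<open>C\<close> lies below \<open>m\<close>; then \<open>m \<in> N\<close> pulls
    \<open>B\<close> into \<open>N\<close>.\<close>
  have "B \<subseteq> N"
  proof
    fix b assume "b \<in> B"
    then have b: "b \<in> C" using C_over_B by blast
    have "b \<le> m" using PIM_C b mM mC unfolding PIM_def by (meson linear)
    moreover have "b \<in> nonneg_part M" using PIM_C b unfolding PIM_def by blast
    ultimately show "b \<in> N" using \<open>PIM M N\<close> mN unfolding PIM_def by blast
  qed
  then have "B \<subseteq> N \<inter> \<Gamma>" using C_over_B by blast
  \<comment> \<open>Otherwise \<open>N\<close> would lie over \<open>B\<close> and hence inside
    \<open>C\<close>, although \<open>m \<in> N\<close> and \<open>m \<notin> C\<close>.\<close>
  moreover have "N \<inter> \<Gamma> \<noteq> B"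
    using PIM_closure_maximal[OF \<open>PIM M N\<close>, of \<Gamma> "order_hull M B"] mN mC hull_B(2)
    unfolding C_def by blast
  ultimately obtain g where g: "g \<in> N" "g \<in> \<Gamma>" "g \<notin> B" by blast
  then obtain p where p: "p \<in> F" "p \<noteq> \<zero>" "w p = Fin g" unfolding finite_values_def by auto
  have "p \<in> O\<^sub>F"
    using p g(1) by (auto simp: mem_O\<^sub>F N_def nonneg_part_def zero_with_infty_def)
  \<comment> \<open>If \<open>p\<close> were outside \<open>P\<close>, its value \<open>g\<close>
    would be in \<open>B\<close>.\<close>
  then have "p \<in> P" using p(3) g(3) unfolding B_def by blast
  moreover obtain n :: nat where "w p \<le> w (x [^] n)" using g(1) p(3) unfolding N_def by auto
  ultimately show thesis using that p(2) by blast
qed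

text \<open>Exponent 0 is included because \<open>ex_value_le_nat_pow\<close> does not promise a
  positive one; in that case \<open>\<one> \<in> Q\<close> contradicts properness.\<close>

lemma nat_pow_in_primeideal:
  assumes Q: "primeideal Q (E\<lparr>carrier := O\<^sub>E\<rparr>)" and x: "x \<in> O\<^sub>E" "x [^] (n::nat) \<in> Q"
  shows "x \<in> Q"
proof -
  interpret Q: primeideal Q "E\<lparr>carrier := O\<^sub>E\<rparr>" by (rule Q)
  show ?thesis using x(2)
  proof (induction n)
    case 0
    then show ?case using Q.one_imp_carrier Q.I_notcarr by simp
  next
    case (Suc n)
    have "x [^] n \<in> O\<^sub>E" by (rule nat_pow_closed_O\<^sub>E[OF x(1)])
    then have "x [^] n \<in> Q \<or> x \<in> Q"
      using Q.I_prime[of "x [^] n" x] Suc.prems x(1) by simp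
    then show ?case using Suc.IH by blast
  qed
qed

lemma I_subset_prime:
  assumes Q: "primeideal Q (E\<lparr>carrier := O\<^sub>E\<rparr>)" "Q \<inter> O\<^sub>F = P"
  shows "I \<subseteq> Q"
proof
  interpret Q: primeideal Q "E\<lparr>carrier := O\<^sub>E\<rparr>" by (rule Q)
  fix x assume x: "x \<in> I"
  show "x \<in> Q"
  proof (cases "x = \<zero>")
    case True
    then show ?thesis using additive_subgroup.zero_closed[OF Q.is_additive_subgroup] by simp
  next
    case False
    with x obtain p and n :: nat where p: "p \<in> P" "p \<noteq> \<zero>" "w p \<le> w (x [^] n)"
      by (rule ex_value_le_nat_pow)
    have xO: "x \<in> O\<^sub>E" using x unfolding I_def by blast
    have "p \<in> F" "x [^] n \<in> carrier E"
      using p P_subset nat_pow_closed_O\<^sub>E[OF xO] by (auto simp: mem_O\<^sub>F mem_O\<^sub>E)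
    note dvd = dvd_if_le[OF this(1) p(2) this(2) p(3)]
    have "p \<otimes> (inv p \<otimes> x [^] n) \<in> Q"
      using Q.I_r_closed[of p] p(1) Q(2) dvd(1) by auto
    then show ?thesis using dvd(2) nat_pow_in_primeideal[OF Q(1) xO] by simp
  qed
qed

section \<open>Primes over \<open>P\<close> avoiding an element, and the radical\<close>

lemma exists_prime_avoiding:
  assumes x: "x \<in> O\<^sub>E" "\<And>n::nat. n > 0 \<Longrightarrow> x [^] n \<notin> I"
  shows "\<exists>Q. primeideal Q (E\<lparr>carrier := O\<^sub>E\<rparr>) \<and> Q \<inter> O\<^sub>F = P \<and> x \<notin> Q"
proof -
  interpret R: cring "E\<lparr>carrier := O\<^sub>E\<rparr>" by (rule cring_O\<^sub>E)
  note O = subringE[OF subring_O\<^sub>E]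
  \<comment> \<open>Taking \<open>n = 0\<close> puts \<open>O\<^sub>F - P\<close> into
    \<open>S\<close>, and taking \<open>n = 1\<close>, \<open>a = \<one>\<close> puts
    \<open>x\<close> there. A prime missing \<open>S\<close> thus omits \<open>x\<close> and meets
    \<open>O\<^sub>F\<close> inside \<open>P\<close>; the reverse inclusion comes from
    \<open>P_subset_I\<close>.\<close>
  define S where "S = {x [^] (n::nat) \<otimes> a |n a. a \<in> O\<^sub>F - P}"
  have xc: "x \<in> carrier E" using x mem_O\<^sub>E by blast
  have Fc: "a \<in> carrier E" if "a \<in> O\<^sub>F - P" for a
    using that by (simp add: mem_O\<^sub>F subfield_carrier)
  have one_notin_I: "\<one> \<notin> I" using value_in_C_iff one_notin_P unfolding I_def by blast
  \<comment> \<open>The hypothesis speaks of positive exponents; exponent 0 is covered by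
    \<open>one_notin_I\<close>.\<close>
  have "x [^] n \<in> O\<^sub>E - I" for n :: nat
    using x one_notin_I nat_pow_closed_O\<^sub>E by (cases "n = 0") (auto simp: O(3))
  then have IS: "I \<inter> S = {}" using mult_notin_I unfolding S_def by blast
  have "\<exists>Q. primeideal Q (E\<lparr>carrier := O\<^sub>E\<rparr>) \<and> I \<subseteq> Q \<and> Q \<inter> S = {}"
  proof (rule R.exists_primeideal_disjoint[OF ideal_I _ _ _ IS])
    show "S \<subseteq> carrier (E\<lparr>carrier := O\<^sub>E\<rparr>)"
      using O(6) nat_pow_closed_O\<^sub>E[OF x(1)] O\<^sub>F_subset unfolding S_def by auto
    have "\<one> = x [^] (0::nat) \<otimes> \<one>" by simp
    then have "\<one> \<in> S" using one_notin_P unfolding S_def by blast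
    then show "\<one>\<^bsub>E\<lparr>carrier := O\<^sub>E\<rparr>\<^esub> \<in> S" by simp
    fix s t assume "s \<in> S" "t \<in> S"
    then obtain i j :: nat and a b
      where st: "s = x [^] i \<otimes> a" "t = x [^] j \<otimes> b" and ab: "a \<in> O\<^sub>F - P" "b \<in> O\<^sub>F - P"
      unfolding S_def by blast
    have "s \<otimes> t = (x [^] i \<otimes> x [^] j) \<otimes> (a \<otimes> b)"
      unfolding st using xc ab[THEN Fc] by (simp add: m_ac)
    then have "s \<otimes> t = x [^] (i + j) \<otimes> (a \<otimes> b)" using xc by (simp add: nat_pow_mult)
    then have "s \<otimes> t \<in> S" using mult_notin_P[OF ab] unfolding S_def by blast
    then show "s \<otimes>\<^bsub>E\<lparr>carrier := O\<^sub>E\<rparr>\<^esub> t \<in> S" by simp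
  qed
  then obtain Q where Q: "primeideal Q (E\<lparr>carrier := O\<^sub>E\<rparr>)" "I \<subseteq> Q" "Q \<inter> S = {}" by blast
  have "a \<in> S" if "a \<in> O\<^sub>F - P" for a
  proof -
    have "a = x [^] (0::nat) \<otimes> a" using Fc[OF that] by simp
    then show ?thesis using that unfolding S_def by blast
  qed
  then have "Q \<inter> O\<^sub>F = P" using Q P_subset_I P_subset by blast
  moreover have "x = x [^] (1::nat) \<otimes> \<one>" using xc by simp
  then have "x \<in> S" using one_notin_P unfolding S_def by blast
  ultimately show ?thesis using Q by blast
qed

lemma radical_I:
  "ideal_radical (E\<lparr>carrier := O\<^sub>E\<rparr>) I =
    \<Inter> {Q. primeideal Q (E\<lparr>carrier := O\<^sub>E\<rparr>) \<and> Q \<inter> O\<^sub>F = P}" (is "_ = \<Inter> ?\<Q>")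
proof
  show "ideal_radical (E\<lparr>carrier := O\<^sub>E\<rparr>) I \<subseteq> \<Inter> ?\<Q>"
    using I_subset_prime nat_pow_in_primeideal
    by (auto simp: ideal_radical_def nat_pow_O\<^sub>E) blast
  show "\<Inter> ?\<Q> \<subseteq> ideal_radical (E\<lparr>carrier := O\<^sub>E\<rparr>) I"
  proof
    fix x assume x: "x \<in> \<Inter> ?\<Q>"
    \<comment> \<open>An empty intersection would be the whole type, so a prime over
      \<open>P\<close> is needed before \<open>x \<in> O\<^sub>E\<close> can be concluded; avoiding
      \<open>\<one>\<close> produces one.\<close>
    have "\<one> \<notin> I" using value_in_C_iff one_notin_P unfolding I_def by blast
    then obtain Q where Q: "Q \<in> ?\<Q>"
      using exists_prime_avoiding[of \<one>] subringE(3)[OF subring_O\<^sub>E] by auto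
    then have "x \<in> Q" "Q \<subseteq> O\<^sub>E"
      using x primeideal.axioms(1) ideal.axioms(1) additive_subgroup.a_subset by fastforce+
    then have "x \<in> O\<^sub>E" by blast
    then show "x \<in> ideal_radical (E\<lparr>carrier := O\<^sub>E\<rparr>) I"
      using exists_prime_avoiding[of x] x by (auto simp: ideal_radical_def nat_pow_O\<^sub>E)
  qed
qed

end

section \<open>Translation along the embedding of value groups\<close>

lemma finite_values_map:
  assumes "\<And>x. x \<in> carrier A \<Longrightarrow> w x = map_with_infty \<iota> (v x)"
  shows "finite_values A w = \<iota> ` finite_values A v"
proof -
  have "w x = Fin m \<longleftrightarrow> (\<exists>g. v x = Fin g \<and> m = \<iota> g)" if "x \<in> carrier A" for x m
    using assms[OF that] by (cases "v x") auto
  then show ?thesis unfolding finite_values_def by auto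
qed

text \<open>\<open>\<iota>\<close> is controlled only on \<open>\<Gamma>\<close>, hence the
  condition on finite \<open>a\<close>.\<close>

lemma map_with_infty_nonneg_iff:
  assumes "ordered_monoid_embedding \<Gamma> \<iota>" "0 \<in> \<Gamma>" "\<And>g. a = Fin g \<Longrightarrow> g \<in> \<Gamma>"
  shows "0 \<le> map_with_infty \<iota> a \<longleftrightarrow> 0 \<le> a"
proof (cases a)
  case (Fin g)
  then have "\<iota> 0 \<le> \<iota> g \<longleftrightarrow> 0 \<le> g"
    using assms unfolding ordered_monoid_embedding_def by blast
  then show ?thesis
    using Fin assms(1) by (simp add: ordered_monoid_embedding_def zero_with_infty_def)
qed (simp add: zero_with_infty_def)

theorem proposition4p19:
  fixes E :: "('a, 'b) ring_scheme"
    and F :: "'a set"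
    and v :: "'a \<Rightarrow> 'g::linordered_ab_group_add with_infty"
    and w :: "'a \<Rightarrow> 'm::{linorder, ordered_comm_monoid_add} with_infty"
    and \<iota> :: "'g \<Rightarrow> 'm"
    and P :: "'a set"
    and Ov Ow I :: "'a set"
    and \<Gamma> H :: "'g set"
    and Mw C :: "'m set"
  assumes "field E" and "subfield F E" and "ring.finite_dimension E F (carrier E)"
    and "valuation (E\<lparr>carrier := F\<rparr>) v"
    and "quasi_valuation E w"
    and "extends_along (E\<lparr>carrier := F\<rparr>) \<iota> v w"
    and "Ov = nonneg_elements (E\<lparr>carrier := F\<rparr>) v"
    and "Ow = nonneg_elements E w"
    and "\<Gamma> = value_group (E\<lparr>carrier := F\<rparr>) v"
    and "Mw = value_monoid E w"
    and "primeideal P (E\<lparr>carrier := Ov\<rparr>)"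
    and "H = isolated_subgroup_of_prime (E\<lparr>carrier := F\<rparr>) v P"
    and "C = PIM_closure Mw (\<iota> ` \<Gamma>) (order_hull Mw (nonneg_part (\<iota> ` H)))"
    and "I = {x \<in> Ow. w x \<notin> Fin ` C}"
  shows "ideal_radical (E\<lparr>carrier := Ow\<rparr>) I =
    \<Inter> {Q. primeideal Q (E\<lparr>carrier := Ow\<rparr>) \<and> Q \<inter> Ov = P}"
proof -
  let ?F = "E\<lparr>carrier := F\<rparr>"
  interpret E: field E by fact
  have F: "F \<subseteq> carrier E" "\<one>\<^bsub>E\<^esub> \<in> F" "\<one>\<^bsub>E\<^esub> \<noteq> \<zero>\<^bsub>E\<^esub>" "\<zero>\<^bsub>E\<^esub> \<in> F"
    using subringE(1-3)[OF subfieldE(1)[OF assms(2)]] by auto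
  have v: "\<And>x. x \<in> F \<Longrightarrow> v x = Infty \<longleftrightarrow> x = \<zero>\<^bsub>E\<^esub>"
    "\<And>x y. x \<in> F \<Longrightarrow> y \<in> F \<Longrightarrow> v (x \<otimes>\<^bsub>E\<^esub> y) = v x + v y"
    using assms(4) by (auto simp: valuation_def)
  have emb: "ordered_monoid_embedding \<Gamma> \<iota>"
    and w: "\<And>x. x \<in> F \<Longrightarrow> w x = map_with_infty \<iota> (v x)"
    using assms(6,9) by (auto simp: extends_along_def)
  have in_\<Gamma>: "g \<in> \<Gamma>" if "x \<in> F" "v x = Fin g" for x g
    using that v(1)[OF that(1)] assms(9) by (auto simp: finite_values_def)
  have v1: "v \<one>\<^bsub>E\<^esub> = 0"
  proof -
    obtain g where g: "v \<one>\<^bsub>E\<^esub> = Fin g" using v(1)[OF F(2)] F(3) by (cases "v \<one>\<^bsub>E\<^esub>") auto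
    then have "g + g = g" using v(2)[OF F(2) F(2)] by simp
    then show ?thesis using g by (simp add: zero_with_infty_def)
  qed
  then have \<Gamma>0: "0 \<in> \<Gamma>" using in_\<Gamma>[OF F(2)] by (simp add: zero_with_infty_def)
  have nonneg: "0 \<le> w x \<longleftrightarrow> 0 \<le> v x" if "x \<in> F" for x
    using map_with_infty_nonneg_iff[OF emb \<Gamma>0] in_\<Gamma> w that by simp
  have Ov: "Ov = nonneg_elements ?F w"
    using nonneg assms(7) by (auto simp: nonneg_elements_def)
  interpret quasi_valuation_over_subfield E F w
  proof (intro quasi_valuation_over_subfield.intro quasi_valuation_over_subfield_axioms.intro)
    show "w \<one>\<^bsub>E\<^esub> = 0"
      using w[OF F(2)] v1 emb by (simp add: zero_with_infty_def ordered_monoid_embedding_def)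
    show "w (x \<otimes>\<^bsub>E\<^esub> y) = w x + w y" if xy: "x \<in> F" "y \<in> F" for x y
    proof -
      have "x \<otimes>\<^bsub>E\<^esub> y \<in> F" using xy subringE(6)[OF subfieldE(1)[OF assms(2)]] by blast
      then show ?thesis
        using w xy v(2)[OF xy] in_\<Gamma>[OF xy(1)] in_\<Gamma>[OF xy(2)] emb
        by (cases "v x"; cases "v y") (auto simp: ordered_monoid_embedding_def)
    qed
  qed (rule assms(1) assms(2) assms(5))+
  interpret quasi_valuation_over_prime E F w P
    using assms(11) unfolding Ov
    by (intro quasi_valuation_over_prime.intro quasi_valuation_over_prime_axioms.intro
        quasi_valuation_over_subfield_axioms)
  \<comment> \<open>The locale starts from the values taken on \<open>O\<^sub>F - P\<close>, the
    theorem from the nonnegative part of the isolated subgroup; here the two are matched.\<close>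
  have "nonneg_part (\<iota> ` H) = B"
  proof -
    have H: "Fin g \<in> v ` (Ov - P) \<longleftrightarrow> g \<in> H \<and> 0 \<le> g" for g
    proof
      assume "Fin g \<in> v ` (Ov - P)"
      then obtain x where x: "x \<in> Ov" "x \<notin> P" "v x = Fin g" by force
      then have xF: "x \<in> F" and g: "0 \<le> g"
        using assms(7) by (auto simp: nonneg_elements_def zero_with_infty_def)
      have "Fin g \<noteq> v p \<and> Fin (- g) \<noteq> v p" if p: "p \<in> P" for p
      proof -
        have pO: "p \<in> Ov" using p P_subset Ov by blast
        have pF: "p \<in> F" "0 \<le> v p" using pO assms(7) by (auto simp: nonneg_elements_def)
        have "v p \<noteq> v x"
          using P_upward_closed[OF p, of x] x(1,2) Ov w xF pF by auto
        \<comment> \<open>Since \<open>g\<close> and \<open>v p\<close> are both nonnegative,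
          \<open>v p = - g\<close> forces both to be 0, which is the case just excluded.\<close>
        moreover have "v p = v x" if "Fin (- g) = v p"
          using that[symmetric] pF(2) g x(3) by (auto simp: zero_with_infty_def)
        ultimately show ?thesis using x(3) by auto
      qed
      then show "g \<in> H \<and> 0 \<le> g"
        using in_\<Gamma>[OF xF x(3)] g assms(9,12) unfolding isolated_subgroup_of_prime_def by blast
    next
      assume g: "g \<in> H \<and> 0 \<le> g"
      \<comment> \<open>Any \<open>x\<close> of value \<open>g\<close> serves: no element of
        \<open>P\<close> has its value in \<open>H\<close>.\<close>
      then obtain x where x: "x \<in> F" "v x = Fin g" "x \<notin> P"
        using assms(12) unfolding isolated_subgroup_of_prime_def finite_values_def by force
      then have "x \<in> Ov - P" using assms(7) g by (auto simp: nonneg_elements_def zero_with_infty_def)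
      then show "Fin g \<in> v ` (Ov - P)" using x(2) by force
    qed
    have pos: "0 \<le> \<iota> g \<longleftrightarrow> 0 \<le> g" if "g \<in> H" for g
      using map_with_infty_nonneg_iff[OF emb \<Gamma>0, of "Fin g"] that assms(9,12)
      by (auto simp: isolated_subgroup_of_prime_def zero_with_infty_def)
    have "m \<in> B \<longleftrightarrow> (\<exists>g. Fin g \<in> v ` (Ov - P) \<and> m = \<iota> g)" for m
    proof -
      have "w x = Fin m \<longleftrightarrow> (\<exists>g. v x = Fin g \<and> m = \<iota> g)" if "x \<in> Ov" for x
        using w[of x] that assms(7) by (cases "v x") (auto simp: nonneg_elements_def)
      then have "m \<in> B \<longleftrightarrow> (\<exists>x\<in>Ov - P. \<exists>g. v x = Fin g \<and> m = \<iota> g)"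
        unfolding B_def Ov[symmetric] by auto
      then show ?thesis by (metis image_iff)
    qed
    then show ?thesis using H pos unfolding nonneg_part_def by auto
  qed
  moreover have "finite_values ?F w = \<iota> ` \<Gamma>"
    using finite_values_map[of ?F w \<iota> v] w assms(9) by simp
  ultimately have "C = quasi_valuation_over_prime.C E F w P"
    using assms(10,13) by (simp add: C_def)
  then show ?thesis using radical_I assms(8,14) Ov by (simp add: I_def)
qed

end
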